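(* Let $p$ and $q$ be distinct primes, let $G$ be a cyclic group of order $p^2q^2$ with identity $e_G$, let $S_1=\{x\in G: |x|=p \text{ or } |x|=q\}$, $S_2=\{x\in G: |x|=p^2 \text{ or } |x|=q^2\}$, $S_3=\{e_G\}$. Then the girth of the Bi-Cayley graph $\Gamma=\mathrm{BiCay}(G;S_1,S_2,S_3)$ is $3$.
   Context: $|x|$ denotes the order of the element $x$. For a group $G$ and nonempty subsets $S_1,S_2,S_3\subseteq G$ with $S_1,S_2,S_3$ inverse-closed and $e_G\notin S_1\cup S_2$, the Bi-Cayley graph $\mathrm{BiCay}(G;S_1,S_2,S_3)$ is the simple graph with vertex set $\{0,1\}\times G$ in which two distinct vertices $(i,x),(j,y)$ are adjacent iff: $xy^{-1}\in S_1$ when $i=j=0$; $xy^{-1}\in S_2$ when $i=j=1$; $xy^{-1}\in S_3$ when $i\ne j$. The girth is the length of a shortest cycle. *)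

theory Defs
  imports
    "HOL-Algebra.Algebra"
    "HOL-Computational_Algebra.Primes"
    "HOL-Library.Extended_Nat"
    "Graph_Theory.Pair_Digraph"
begin

text \<open>
  Simple undirected graphs are represented as in the Graph_Theory entry: as symmetric loop-free
  digraphs whose arcs are ordered pairs of vertices.

  For arbitrary \<^term>\<open>S1\<close>, \<^term>\<open>S2\<close>, \<^term>\<open>S3\<close> the arc relation below need not be symmetric; it is
  when all three sets are inverse-closed (see the lemma that follows), which is the only situation
  in which Bi-Cayley graphs are considered.
\<close>

definition bi_cayley ::
  "('a, 'b) monoid_scheme \<Rightarrow> 'a set \<Rightarrow> 'a set \<Rightarrow> 'a set \<Rightarrow> (nat \<times> 'a) pair_pre_digraph" where
  "bi_cayley G S1 S2 S3 =
    \<lparr> pverts = {0, 1} \<times> carrier G,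
      parcs = {((i, x), (j, y)) | i x j y.
        (i, x) \<in> {0, 1} \<times> carrier G \<and> (j, y) \<in> {0, 1} \<times> carrier G \<and>
        (i, x) \<noteq> (j, y) \<and>
        (i = 0 \<and> j = 0 \<longrightarrow> x \<otimes>\<^bsub>G\<^esub> inv\<^bsub>G\<^esub> y \<in> S1) \<and>
        (i = 1 \<and> j = 1 \<longrightarrow> x \<otimes>\<^bsub>G\<^esub> inv\<^bsub>G\<^esub> y \<in> S2) \<and>
        (i \<noteq> j \<longrightarrow> x \<otimes>\<^bsub>G\<^esub> inv\<^bsub>G\<^esub> y \<in> S3)} \<rparr>"

lemma bi_cayley_bidirected:
  assumes "group G"
    and closed: "\<And>s. s \<in> S1 \<Longrightarrow> inv\<^bsub>G\<^esub> s \<in> S1" "\<And>s. s \<in> S2 \<Longrightarrow> inv\<^bsub>G\<^esub> s \<in> S2"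
      "\<And>s. s \<in> S3 \<Longrightarrow> inv\<^bsub>G\<^esub> s \<in> S3"
  shows "pair_bidirected_digraph (bi_cayley G S1 S2 S3)"
proof -
  interpret group G by fact
  have inv_quot: "y \<otimes>\<^bsub>G\<^esub> inv\<^bsub>G\<^esub> x \<in> S"
    if "x \<otimes>\<^bsub>G\<^esub> inv\<^bsub>G\<^esub> y \<in> S" "x \<in> carrier G" "y \<in> carrier G"
      "\<And>s. s \<in> S \<Longrightarrow> inv\<^bsub>G\<^esub> s \<in> S" for x y S
    using that(4)[OF that(1)] that(2,3) by (simp add: inv_mult_group)
  have sym: "(w, v) \<in> parcs (bi_cayley G S1 S2 S3)"
    if arc: "(v, w) \<in> parcs (bi_cayley G S1 S2 S3)" for v w
  proof -
    obtain i x j y where vw: "v = (i, x)" "w = (j, y)"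
      by (cases v, cases w)
    show ?thesis
      using arc inv_quot[of x y S1] inv_quot[of x y S2] inv_quot[of x y S3] closed
      unfolding vw bi_cayley_def by auto
  qed
  show ?thesis
  proof
    show "symmetric (with_proj (bi_cayley G S1 S2 S3))"
      using sym by (simp add: symmetric_def sym_def)
  qed (auto simp: bi_cayley_def)
qed

text \<open>
  The notion \<^const>\<open>pre_digraph.cycle\<close> admits the closed walk \<open>u, v, u\<close> traversing an edge back and
  forth. This is not a cycle of the underlying undirected graph and is excluded by the length bound;
  closed walks of length at least 3 without repeated vertices are exactly the undirected cycles.
  The girth of an acyclic graph is \<^term>\<open>\<infinity> :: enat\<close>.
\<close>

definition girth :: "'v pair_pre_digraph \<Rightarrow> enat" where
  "girth \<Gamma> = (INF c \<in> {c. pre_digraph.cycle (with_proj \<Gamma>) c \<and> 3 \<le> length c}. enat (length c))"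

end

theory Submission
  imports Defs
begin

text \<open>Two distinct primes cannot both be 2, so one of them, say \<open>r\<close>, is odd. A
  cyclic group has elements of every order dividing its own; take \<open>x\<close> of order
  \<open>r\<close>. Since \<open>r\<close> is odd, x^2 also has order \<open>r\<close>, so 1, x and
  x^2 are distinct and their quotients lie in \<open>S1\<close>: they span a triangle in layer 0
  (\<open>girth_bi_cayley_eq_3\<close>). No cycle is shorter, as \<open>girth\<close> counts only
  lengths from 3 on.\<close>

lemma girth_ge_3: "3 \<le> girth \<Gamma>"
  unfolding girth_def
  by (rule INF_greatest) (auto simp: numeral_eq_enat)

text \<open>Cycles are directed closed walks here, so three arcs in one cyclic direction already
  attain the bound \<open>girth_ge_3\<close>.\<close>

lemma girth_eq_3I:
  assumes "u \<in> pverts \<Gamma>" "(u, v) \<in> parcs \<Gamma>" "(v, w) \<in> parcs \<Gamma>" "(w, u) \<in> parcs \<Gamma>"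
    and "distinct [u, v, w]"
  shows "girth \<Gamma> = 3"
proof (rule antisym[OF _ girth_ge_3])
  have "pre_digraph.cycle (with_proj \<Gamma>) [(u, v), (v, w), (w, u)]"
    using assms
    by (auto simp: pre_digraph.cycle_def pre_digraph.awalk_def pre_digraph.cas.simps
        pre_digraph.awalk_verts.simps intro!: exI[of _ u])
  then show "girth \<Gamma> \<le> 3"
    unfolding girth_def by (intro INF_lower2) (auto simp: numeral_eq_enat)
qed

text \<open>Oddness makes squaring preserve the order of \<open>x\<close>; it also excludes infinite
  order, for which \<open>ord\<close> is 0.\<close>

lemma girth_bi_cayley_eq_3:
  fixes G (structure)
  assumes "group G" and x: "x \<in> carrier G"
    and odd: "odd (group.ord G x)" and ord: "group.ord G x \<noteq> 1"
    and S1: "\<And>y. y \<in> carrier G \<Longrightarrow> group.ord G y = group.ord G x \<Longrightarrow> y \<in> S1"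
  shows "girth (bi_cayley G S1 S2 S3) = 3"
proof -
  interpret group G by fact
  have sq: "ord (x \<otimes> x) = ord x"
  proof -
    have "gcd (ord x) 2 = 1"
      using odd by simp
    then have "ord (x [^] (2::nat)) = ord x"
      using ord_pow_gen[OF x, of 2] by simp
    then show ?thesis
      using x by (simp add: numeral_2_eq_2)
  qed
  have ne: "x \<noteq> \<one>" "x \<otimes> x \<noteq> \<one>"
    using ord sq ord_id by metis+
  then have neq: "x \<otimes> x \<noteq> x"
    using x by simp
  have inv: "x \<otimes> inv (x \<otimes> x) = inv x"
    using x by (simp add: inv_mult_group flip: m_assoc)
  show ?thesis
    \<comment> \<open>The quotients along the three arcs are \<open>inv x\<close>,
      \<open>inv x\<close> and \<open>x \<otimes> x\<close>, all of the same order as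
      \<open>x\<close>.\<close>
    by (rule girth_eq_3I[of "(0, \<one>)" _ "(0, x)" "(0, x \<otimes> x)"])
      (use x ne neq inv sq in \<open>auto simp: bi_cayley_def intro!: S1\<close>)
qed

text \<open>If \<open>g\<close> generates and |G| = n k, then g^k has order n.\<close>

lemma (in group) cyclic_group_ex_ord:
  assumes "cyclic_group G" and "finite (carrier G)" and "n dvd order G"
  obtains x where "x \<in> carrier G" "ord x = n"
proof -
  obtain g where g: "g \<in> carrier G" "subgroup_generated G {g} = G"
    using assms(1) unfolding cyclic_group_def by blast
  then have "generate G {g} = carrier G"
    using carrier_subgroup_generated[of G "{g}"] by simp
  then have "ord g = order G"
    using generate_pow_card[OF g(1)] by (simp add: order_def)
  moreover obtain k where k: "order G = n * k"
    using assms(3) by blast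
  \<comment> \<open>This forces \<open>k\<close> to be nonzero, so that \<open>ord_pow\<close>
    applies and the division by \<open>k\<close> leaves \<open>n\<close>.\<close>
  moreover have "0 < order G"
    using assms(2) by (simp add: order_gt_0_iff_finite)
  ultimately have "ord (g [^] k) = n"
    using ord_pow[OF g(1), of k] by simp
  then show thesis
    using that g(1) by blast
qed

theorem theorem2p12:
  fixes G :: "('a, 'b) monoid_scheme" and p q :: nat and S1 S2 S3 :: "'a set"
  assumes "Factorial_Ring.prime p" and "Factorial_Ring.prime q" and "p \<noteq> q"
    and "group G" and "cyclic_group G" and "order G = p\<^sup>2 * q\<^sup>2"
    and "S1 = {x \<in> carrier G. group.ord G x = p \<or> group.ord G x = q}"
    and "S2 = {x \<in> carrier G. group.ord G x = p\<^sup>2 \<or> group.ord G x = q\<^sup>2}"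
    and "S3 = {\<one>\<^bsub>G\<^esub>}"
  shows "girth (bi_cayley G S1 S2 S3) = 3"
proof -
  interpret group G by fact
  have pos: "0 < p" "0 < q"
    using assms(1,2) by (simp_all add: prime_gt_0_nat)
  then have "finite (carrier G)"
    using assms(6) by (simp flip: order_gt_0_iff_finite)
  moreover obtain r where r: "r = p \<or> r = q" "odd r"
    \<comment> \<open>An even prime equals 2, so \<open>p\<close> and \<open>q\<close> both even
      would give \<open>p = q\<close>.\<close>
    using assms(1-3) primes_dvd_imp_eq two_is_prime_nat by metis
  moreover have "r dvd order G"
    using r(1) assms(6) by (auto simp: power2_eq_square)
  ultimately obtain x where x: "x \<in> carrier G" "ord x = r"
    using cyclic_group_ex_ord[OF assms(5)] by metis
  moreover have "r \<noteq> 1"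
    using r(1) assms(1,2) by auto
  ultimately show ?thesis
    using r assms(7) by (intro girth_bi_cayley_eq_3[OF \<open>group G\<close> x(1)]) auto
qed

end
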